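(* Let $p>1$ and let $f,g,\rho,d$ satisfy the standing assumptions. Assume that the limit $\ell_0:=\lim_{u\to0^+}\rho(u)\left(\frac{d(u)}{u}\right)^{\frac1{p-1}}$ exists and $\ell_0<+\infty$, and let $c^*$ be the threshold speed. Let $u$ be a traveling wave solution, defined in $(\alpha,\beta)$, with some speed $c>c^*$. Assume that there exist three constants $\delta,\mu,M>0$ and a function $\xi\in C^1[0,\delta]$ such that $$\mu\,\xi(u)\le d(u)(\rho(u))^{p-1}\le M\,\xi(u)\quad\text{for every }u\in(0,\delta).$$ Then $\beta=+\infty$ if and only if $\int_0^{1/2}\frac{1}{\rho(u)}\,du=+\infty$. Moreover, even if $\beta<+\infty$, we have $\lim_{t\to\beta^-}u'(t)=0$.
   Context: Standing assumptions: $p>1$; $f,g,\rho\in C[0,1]$; $d\in C^1(0,1)$; $\rho(u)>0$ in $(0,1)$ and $\rho(0)=\rho(1)=0$; $g(0)>0$ and $\int_0^u g(s)\,ds>0$ for every $u\in(0,1]$; $d(u)>0$ in $(0,1)$ and $\rho\, d^{\frac1{p-1}}\in L^1(0,1)$. A traveling wave solution (t.w.s.) with speed $c\in\mathbb R$ is a function $u\in C^1(\alpha,\beta)$, with $-\infty\le\alpha<\beta\le+\infty$, such that $0<u(t)<1$ for all $t\in(\alpha,\beta)$, $d(u)|u'|^{p-2}u'\in C^1(\alpha,\beta)$, $$(d(u)|u'|^{p-2}u')'+(cg(u)-f(u))u'+\rho(u)=0\quad\text{in }(\alpha,\beta),$$ $u(\alpha^+)=1$, $u(\beta^-)=0$,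 and $\lim_{t\to\alpha^+}d(u)|u'|^{p-2}u'=\lim_{t\to\beta^-}d(u)|u'|^{p-2}u'=0$. When $\ell_0$ exists and is finite, there is a threshold $c^*\in\mathbb R$ such that a t.w.s. with speed $c$ exists if and only if $c\ge c^*$. *)

theory Defs
  imports "HOL-Analysis.Analysis"
begin

(* The derivative is taken within S, so at an endpoint of a closed interval it is one-sided
   (C1_differentiable_on would ask for a two-sided derivative there).  On open S the two agree. *)
definition C1_on :: "(real \<Rightarrow> real) \<Rightarrow> real set \<Rightarrow> bool" where
  "C1_on h S \<longleftrightarrow>
     (\<exists>h'. (\<forall>x\<in>S. (h has_real_derivative h' x) (at x within S)) \<and> continuous_on S h')"

(* f, g and rho matter only on [0,1], d only on (0,1); their values elsewhere are irrelevant. *)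
definition standing_assumptions ::
  "real \<Rightarrow> (real \<Rightarrow> real) \<Rightarrow> (real \<Rightarrow> real) \<Rightarrow> (real \<Rightarrow> real) \<Rightarrow> (real \<Rightarrow> real) \<Rightarrow> bool" where
  "standing_assumptions p f g \<rho> d \<longleftrightarrow>
     p > 1 \<and>
     continuous_on {0..1} f \<and> continuous_on {0..1} g \<and> continuous_on {0..1} \<rho> \<and>
     C1_on d {0<..<1} \<and>
     (\<forall>v\<in>{0<..<1}. \<rho> v > 0) \<and> \<rho> 0 = 0 \<and> \<rho> 1 = 0 \<and>
     g 0 > 0 \<and> (\<forall>v\<in>{0<..1}. integral {0..v} g > 0) \<and>
     (\<forall>v\<in>{0<..<1}. d v > 0) \<and>
     set_integrable lborel {0<..<1} (\<lambda>v. \<rho> v * d v powr (1 / (p - 1)))"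

(* The term d(u)|u'|^(p-2) u'; where u' = 0 it has the intended value 0, also for p < 2. *)
definition flux :: "real \<Rightarrow> (real \<Rightarrow> real) \<Rightarrow> (real \<Rightarrow> real) \<Rightarrow> real \<Rightarrow> real" where
  "flux p d u t = d (u t) * \<bar>deriv u t\<bar> powr (p - 2) * deriv u t"

(* The ends \<alpha>, \<beta> may be infinite; one-sided limits at them are taken along the filters
   at_right \<alpha> and at_left \<beta> on ereal; for infinite ends this gives t -> -oo and t -> +oo. *)
definition traveling_wave ::
  "real \<Rightarrow> (real \<Rightarrow> real) \<Rightarrow> (real \<Rightarrow> real) \<Rightarrow> (real \<Rightarrow> real) \<Rightarrow> (real \<Rightarrow> real) \<Rightarrow>
   real \<Rightarrow> ereal \<Rightarrow> ereal \<Rightarrow> (real \<Rightarrow> real) \<Rightarrow> bool" where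
  "traveling_wave p f g \<rho> d c \<alpha> \<beta> u \<longleftrightarrow>
     \<alpha> < \<beta> \<and>
     C1_on u (einterval \<alpha> \<beta>) \<and>
     (\<forall>t\<in>einterval \<alpha> \<beta>. 0 < u t \<and> u t < 1) \<and>
     C1_on (flux p d u) (einterval \<alpha> \<beta>) \<and>
     (\<forall>t\<in>einterval \<alpha> \<beta>.
        deriv (flux p d u) t + (c * g (u t) - f (u t)) * deriv u t + \<rho> (u t) = 0) \<and>
     ((u \<circ> real_of_ereal) \<longlongrightarrow> 1) (at_right \<alpha>) \<and>
     ((u \<circ> real_of_ereal) \<longlongrightarrow> 0) (at_left \<beta>) \<and>
     ((flux p d u \<circ> real_of_ereal) \<longlongrightarrow> 0) (at_right \<alpha>) \<and>
     ((flux p d u \<circ> real_of_ereal) \<longlongrightarrow> 0) (at_left \<beta>)"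

definition threshold_speed ::
  "real \<Rightarrow> (real \<Rightarrow> real) \<Rightarrow> (real \<Rightarrow> real) \<Rightarrow> (real \<Rightarrow> real) \<Rightarrow> (real \<Rightarrow> real) \<Rightarrow> real \<Rightarrow> bool" where
  "threshold_speed p f g \<rho> d cs \<longleftrightarrow>
     (\<forall>c. (\<exists>\<alpha> \<beta> u. traveling_wave p f g \<rho> d c \<alpha> \<beta> u) \<longleftrightarrow> c \<ge> cs)"

end

(* With q = 1/(p-1), a traveling wave is strictly decreasing, and w(v) = d(u)|u'|^(p-1) as a function
   of v = u satisfies w' = c g - f - rho (d/w)^q, w(0) = w(1) = 0.  The damping term rho (d/w)^q equals
   rho(u)/|u'|, so everything follows once it is trapped between two positive constants near 0.
   Upper bound: w >= k xi for small k, since below k xi the damping would make w decrease from w(0) = 0.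
   Lower bound: comparing with the solution for the threshold speed c* < c gives
   w(v) <= a v with a < c g(0) - f(0).  If l0 > 0 this suffices.  If l0 = 0, then xi'(0) = 0, and
   either w <= K xi, or w >= K xi with a damping so small that w grows faster than a v. *)

theory Submission
  imports Defs
begin

text \<open>The equation for \<open>w\<close> divides by \<open>w\<close>, which vanishes at 0, so
  the usual Lipschitz comparison cannot start from that end. It is replaced by a crossing argument:
  a function whose derivative is positive at each of its zeros cannot pass from positive to
  nonpositive, hence has a settled sign on some right neighbourhood of 0. Every comparison of
  \<open>w\<close> with another solution or with a multiple of \<xi> is such a dichotomy, one branch
  of which is refuted. The threshold wave enters because the equation at speed c alone gives w(v) <
  a v only for a > c g(0) - f(0), the wrong side for the lower bound. A smaller slope is borrowed
  from the slower solution, which lies above \<open>w\<close> near 0. That ordering cannot be seen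
  at 0, where the larger speed pushes \<open>w\<close> up; it is forced by the condition w(1) = 0 at
  the far end.\<close>

section \<open>Sign of a function near 0 from its derivative\<close>

text \<open>At the leftmost point \<open>s\<close> with \<phi> \<le> 0, continuity gives \<phi> = 0,
  and the positive derivative then makes \<phi> negative just left of \<open>s\<close>, against
  minimality. The sign of the derivative is prescribed at zeros only, which is all a barrier
  argument provides.\<close>

lemma nonpos_backwards:
  fixes \<phi> :: "real \<Rightarrow> real"
  assumes "a \<le> b" "\<phi> b \<le> 0"
    and deriv: "\<And>x. x \<in> {a..b} \<Longrightarrow> (\<phi> has_real_derivative \<phi>' x) (at x)"
    and pos: "\<And>x. x \<in> {a..b} \<Longrightarrow> \<phi> x = 0 \<Longrightarrow> \<phi>' x > 0"
  shows "\<phi> a \<le> 0"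
proof (rule ccontr)
  assume "\<not> \<phi> a \<le> 0"
  then have a: "\<phi> a > 0" by simp
  define S where "S = {x \<in> {a..b}. \<phi> x \<le> 0}"
  have cont: "continuous_on {a..b} \<phi>"
    using deriv by (meson DERIV_isCont continuous_at_imp_continuous_on)
  have S: "compact S" "S \<noteq> {}"
    using assms(1,2) continuous_on_closed_Collect_le[OF cont continuous_on_const, of 0]
    by (auto simp: S_def compact_eq_bounded_closed intro: bounded_subset[of "{a..b}"])
  then obtain s where s: "s \<in> S" "\<And>x. x \<in> S \<Longrightarrow> s \<le> x"
    using compact_attains_inf by metis
  have "s \<noteq> a" "s \<in> {a..b}" "\<phi> s \<le> 0" using s(1) a by (auto simp: S_def)
  then have "a < s" by auto
  have left: "\<phi> x > 0" if "x \<in> {a..<s}" for x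
    using that s(2)[of x] \<open>s \<in> {a..b}\<close> by (force simp: S_def)
  have "\<phi> s \<ge> 0"
  proof (rule ccontr)
    assume "\<not> \<phi> s \<ge> 0"
    then obtain x where "a \<le> x" "x \<le> s" "\<phi> x = 0"
      using IVT2'[of \<phi> s 0 a] a \<open>a < s\<close> continuous_on_subset[OF cont] \<open>s \<in> {a..b}\<close> by force
    with left[of x] \<open>\<not> \<phi> s \<ge> 0\<close> show False by (cases "x = s") auto
  qed
  with \<open>\<phi> s \<le> 0\<close> have "\<phi> s = 0" by simp
  then obtain e where e: "e > 0" "\<And>h. 0 < h \<Longrightarrow> h < e \<Longrightarrow> \<phi> (s - h) < \<phi> s"
    using DERIV_pos_inc_left[OF deriv pos] \<open>s \<in> {a..b}\<close> by metis
  define h where "h = min (e/2) (s - a)"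
  have "0 < h" "h < e" "s - h \<in> {a..<s}" using \<open>a < s\<close> e(1) by (auto simp: h_def min_def)
  then show False using e(2)[of h] left[of "s - h"] \<open>\<phi> s = 0\<close> by simp
qed

text \<open>A single point near 0 with \<phi> \<le> 0 passes this sign on to everything on its left,
  so oscillation at 0 is excluded.\<close>

lemma pos_or_nonpos_at_right:
  fixes \<phi> :: "real \<Rightarrow> real"
  assumes "\<forall>\<^sub>F x in at_right 0. (\<phi> has_real_derivative \<phi>' x) (at x) \<and> (\<phi> x = 0 \<longrightarrow> \<phi>' x > 0)"
  shows "(\<forall>\<^sub>F x in at_right 0. \<phi> x > 0) \<or> (\<forall>\<^sub>F x in at_right 0. \<phi> x \<le> 0)"
proof -
  obtain y where y: "y > 0" 
    "\<And>x. 0 < x \<Longrightarrow> x < y \<Longrightarrow> (\<phi> has_real_derivative \<phi>' x) (at x) \<and> (\<phi> x = 0 \<longrightarrow> \<phi>' x > 0)"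
    using assms unfolding eventually_at_right_field by auto
  show ?thesis
  proof (cases "\<forall>x. 0 < x \<longrightarrow> x < y \<longrightarrow> \<phi> x > 0")
    case True
    then show ?thesis using y(1) unfolding eventually_at_right_field by blast
  next
    case False
    then obtain z where z: "0 < z" "z < y" "\<phi> z \<le> 0" by force
    have "\<phi> x \<le> 0" if "0 < x" "x < z" for x
      by (rule nonpos_backwards[of x z \<phi> \<phi>']) (use that z y in auto)
    then show ?thesis using z(1) unfolding eventually_at_right_field by blast
  qed
qed

lemma pos_at_right_if_deriv_pos:
  fixes \<phi> :: "real \<Rightarrow> real"
  assumes lim: "(\<phi> \<longlongrightarrow> 0) (at_right 0)"
    and "\<forall>\<^sub>F x in at_right 0. (\<phi> has_real_derivative \<phi>' x) (at x) \<and> \<phi>' x > 0"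
  shows "\<forall>\<^sub>F x in at_right 0. \<phi> x > 0"
proof -
  obtain y where y: "y > 0" 
    "\<And>x. 0 < x \<Longrightarrow> x < y \<Longrightarrow> (\<phi> has_real_derivative \<phi>' x) (at x) \<and> \<phi>' x > 0"
    using assms(2) unfolding eventually_at_right_field by auto
  have incr: "\<phi> a < \<phi> b" if "0 < a" "a < b" "b < y" for a b
    by (rule DERIV_pos_imp_increasing[OF that(2)]) (use that y(2) in \<open>meson less_le_trans le_less_trans\<close>)
  have "\<phi> x > 0" if x: "0 < x" "x < y" for x
  proof -
    \<comment> \<open>The limit preserves only the weak inequality; stopping at \<open>x/2\<close>
      leaves the strict increase up to \<open>x\<close> to make it strict.\<close>
    have "\<forall>\<^sub>F s in at_right 0. \<phi> s \<le> \<phi> (x/2)"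
      unfolding eventually_at_right_field using incr[of _ "x/2"] x
      by (intro exI[of _ "x/2"]) force
    then have "0 \<le> \<phi> (x/2)"
      by (intro tendsto_upperbound[OF lim]) auto
    then show ?thesis using incr[of "x/2" x] x by simp
  qed
  then show ?thesis using y(1) unfolding eventually_at_right_field by blast
qed

section \<open>Intervals with extended real ends\<close>

text \<open>The filter on \<open>ereal\<close> covers finite and infinite ends at once; the
  extracted real \<open>t0\<close> lets the later arguments work with ordinary real times.\<close>

lemma einterval_at_left:
  fixes \<alpha> \<beta> :: ereal
  assumes "eventually P (at_left \<beta>)" "\<alpha> < \<beta>"
  shows "\<exists>t0\<in>einterval \<alpha> \<beta>. \<forall>t\<in>einterval \<alpha> \<beta>. t0 \<le> t \<longrightarrow> P (ereal t)"
proof -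
  obtain b where b: "b < \<beta>" "\<And>y. b < y \<Longrightarrow> y < \<beta> \<Longrightarrow> P y"
    using assms eventually_at_left[OF assms(2)] by auto
  obtain t where "max \<alpha> b < ereal t" "ereal t < \<beta>"
    using ereal_dense2[of "max \<alpha> b" \<beta>] assms(2) b(1) by auto
  then show ?thesis
    by (intro bexI[of _ t]) (auto simp: einterval_def intro!: b(2) less_le_trans[of b "ereal t"])
qed

lemma einterval_at_right:
  fixes \<alpha> \<beta> :: ereal
  assumes "eventually P (at_right \<alpha>)" "\<alpha> < \<beta>"
  shows "\<exists>t0\<in>einterval \<alpha> \<beta>. \<forall>t\<in>einterval \<alpha> \<beta>. t \<le> t0 \<longrightarrow> P (ereal t)"
proof -
  obtain b where b: "\<alpha> < b" "\<And>y. \<alpha> < y \<Longrightarrow> y < b \<Longrightarrow> P y"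
    using assms eventually_at_right[OF assms(2)] by auto
  obtain t where "\<alpha> < ereal t" "ereal t < min \<beta> b"
    using ereal_dense2[of \<alpha> "min \<beta> b"] assms(2) b(1) by auto
  then show ?thesis
    by (intro bexI[of _ t]) (auto simp: einterval_def intro!: b(2) le_less_trans[of _ "ereal t" b])
qed

lemma C1_on_open_DERIV:
  assumes "C1_on h S" "open S" "x \<in> S"
  shows "(h has_real_derivative deriv h x) (at x)"
  using assms unfolding C1_on_def by (metis DERIV_imp_deriv at_within_open)

lemma einterval_Icc_subset:
  assumes "a \<in> einterval \<alpha> \<beta>" "b \<in> einterval \<alpha> \<beta>"
  shows "{a..b} \<subseteq> einterval \<alpha> \<beta>"
proof
  fix x assume "x \<in> {a..b}"
  then have "ereal a \<le> ereal x" "ereal x \<le> ereal b" by auto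
  then show "x \<in> einterval \<alpha> \<beta>"
    using assms unfolding einterval_iff by (meson le_less_trans less_le_trans)
qed

section \<open>Reduction of the wave to a first-order equation\<close>

locale reaction_convection =
  fixes p :: real and f g \<rho> d :: "real \<Rightarrow> real"
  assumes standing: "standing_assumptions p f g \<rho> d"
begin

lemma p: "p > 1"
  and dpos: "\<And>v. 0 < v \<Longrightarrow> v < 1 \<Longrightarrow> d v > 0"
  and rhopos: "\<And>v. 0 < v \<Longrightarrow> v < 1 \<Longrightarrow> \<rho> v > 0"
  and cont_g: "continuous_on {0..1} g" and cont_\<rho>: "continuous_on {0..1} \<rho>"
  and g0: "g 0 > 0"
  and int_g: "\<And>v. 0 < v \<Longrightarrow> v \<le> 1 \<Longrightarrow> integral {0..v} g > 0"
  and lim_g: "(g \<longlongrightarrow> g 0) (at_right 0)" and lim_f: "(f \<longlongrightarrow> f 0) (at_right 0)"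
  and lim_\<rho>: "(\<rho> \<longlongrightarrow> 0) (at_right 0)"
  using standing continuous_on_Icc_at_rightD[of 0 1]
  by (force simp: standing_assumptions_def)+

definition damping :: "(real \<Rightarrow> real) \<Rightarrow> real \<Rightarrow> real" where
  "damping w v = \<rho> v * (d v / w v) powr (1 / (p - 1))"

text \<open>A singular two-point boundary value problem. The ends are one-sided limits, so the
  values of \<open>w\<close> at 0 and 1 do not matter.\<close>

definition first_order_solution :: "real \<Rightarrow> (real \<Rightarrow> real) \<Rightarrow> bool" where
  "first_order_solution c w \<longleftrightarrow>
    (\<forall>v\<in>{0<..<1}. w v > 0 \<and> (w has_real_derivative c * g v - f v - damping w v) (at v)) \<and>
    (w \<longlongrightarrow> 0) (at_right 0) \<and> (w \<longlongrightarrow> 0) (at_left 1)"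

text \<open>At a zero of the flux u' = 0, and the equation gives the flux the derivative -\<rho>(u)
  < 0. So a nonnegative flux at \<open>t\<close> would be nonnegative at all earlier times,
  \<open>u\<close> would be nondecreasing up to \<open>t\<close> and stay below u(t) < 1, against
  the limit 1 at \<alpha>.\<close>

lemma wave_flux_neg:
  assumes tw: "traveling_wave p f g \<rho> d c \<alpha> \<beta> u"
    and t: "t \<in> einterval \<alpha> \<beta>"
  shows "flux p d u t < 0"
proof (rule ccontr)
  assume neg: "\<not> flux p d u t < 0"
  let ?I = "einterval \<alpha> \<beta>" and ?\<phi> = "flux p d u"
  have ab: "\<alpha> < \<beta>" and C1: "C1_on u ?I" "C1_on ?\<phi> ?I"
    and u01: "\<And>s. s \<in> ?I \<Longrightarrow> 0 < u s \<and> u s < 1"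
    and eq: "\<And>s. s \<in> ?I \<Longrightarrow> deriv ?\<phi> s + (c * g (u s) - f (u s)) * deriv u s + \<rho> (u s) = 0"
    and lim: "((u \<circ> real_of_ereal) \<longlongrightarrow> 1) (at_right \<alpha>)"
    using tw by (auto simp: traveling_wave_def)
  note Du = C1_on_open_DERIV[OF C1(1) open_einterval] and D\<phi> = C1_on_open_DERIV[OF C1(2) open_einterval]
  note sub = einterval_Icc_subset[of _ \<alpha> \<beta>]
  have nonneg: "deriv u s \<ge> 0" if s: "s \<in> ?I" "s \<le> t" for s
  proof -
    have "- ?\<phi> s \<le> 0"
    proof (rule nonpos_backwards[OF s(2), of "\<lambda>x. - ?\<phi> x" "\<lambda>x. - deriv ?\<phi> x"])
      fix x assume "x \<in> {s..t}"
      then have x: "x \<in> ?I" using sub[OF s(1) t] by auto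
      show "((\<lambda>x. - ?\<phi> x) has_real_derivative - deriv ?\<phi> x) (at x)"
        using D\<phi>[OF x] by (rule DERIV_minus)
      assume "- ?\<phi> x = 0"
      then have "deriv u x = 0" using dpos[of "u x"] u01[OF x] by (auto simp: flux_def)
      then show "- deriv ?\<phi> x > 0" using eq[OF x] rhopos[of "u x"] u01[OF x] by simp
    qed (use neg in auto)
    then have "0 \<le> d (u s) * \<bar>deriv u s\<bar> powr (p - 2) * deriv u s" by (simp add: flux_def)
    moreover have "d (u s) * \<bar>deriv u s\<bar> powr (p - 2) > 0" if "deriv u s \<noteq> 0"
      using dpos[of "u s"] u01[OF s(1)] that by simp
    ultimately show ?thesis by (cases "deriv u s = 0") (simp_all add: zero_le_mult_iff)
  qed
  have le: "u s \<le> u t" if s: "s \<in> ?I" "s \<le> t" for s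
    by (rule DERIV_nonneg_imp_nondecreasing[OF s(2)])
      (use Du nonneg sub[OF s(1) t] in \<open>meson atLeastAtMost_iff subsetD\<close>)
  have "\<forall>\<^sub>F x in at_right \<alpha>. (u \<circ> real_of_ereal) x > u t"
    using order_tendstoD(1)[OF lim] u01[OF t] by blast
  from einterval_at_right[OF this ab] obtain t0 where
    "t0 \<in> ?I" "\<And>s. s \<in> ?I \<Longrightarrow> s \<le> t0 \<Longrightarrow> u s > u t" by auto
  moreover have "min t0 t \<in> ?I" using t \<open>t0 \<in> ?I\<close> by (auto simp: min_def)
  ultimately show False using le[of "min t0 t"] by force
qed

text \<open>A strictly decreasing \<open>u\<close> has an inverse \<open>T\<close>, which allows the
  level v = u(t) to replace time. Dividing the wave equation by u' gives w' = c g - f + \<rho>/u',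
  and the formula for u' turns the last term into minus the damping. The end \<beta> becomes v = 0
  and \<alpha> becomes v = 1.\<close>

lemma traveling_wave_first_order:
  assumes tw: "traveling_wave p f g \<rho> d c \<alpha> \<beta> u"
  obtains w where "first_order_solution c w"
    and "\<And>t. t \<in> einterval \<alpha> \<beta> \<Longrightarrow> deriv u t = - ((w (u t) / d (u t)) powr (1 / (p - 1)))"
proof -
  let ?I = "einterval \<alpha> \<beta>" and ?\<phi> = "flux p d u"
  have ab: "\<alpha> < \<beta>" and C1: "C1_on u ?I" "C1_on ?\<phi> ?I"
    and u01: "\<And>s. s \<in> ?I \<Longrightarrow> 0 < u s \<and> u s < 1"
    and eq: "\<And>s. s \<in> ?I \<Longrightarrow> deriv ?\<phi> s + (c * g (u s) - f (u s)) * deriv u s + \<rho> (u s) = 0"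
    and lim: "((u \<circ> real_of_ereal) \<longlongrightarrow> 1) (at_right \<alpha>)" "((u \<circ> real_of_ereal) \<longlongrightarrow> 0) (at_left \<beta>)"
    "((?\<phi> \<circ> real_of_ereal) \<longlongrightarrow> 0) (at_right \<alpha>)" "((?\<phi> \<circ> real_of_ereal) \<longlongrightarrow> 0) (at_left \<beta>)"
    using tw by (auto simp: traveling_wave_def)
  note Du = C1_on_open_DERIV[OF C1(1) open_einterval] and D\<phi> = C1_on_open_DERIV[OF C1(2) open_einterval]
  note sub = einterval_Icc_subset[of _ \<alpha> \<beta>]
  have fneg: "?\<phi> s < 0" if "s \<in> ?I" for s
    using wave_flux_neg[OF tw that] .
  have neg: "deriv u s < 0" if s: "s \<in> ?I" for s
  proof (rule ccontr)
    assume "\<not> deriv u s < 0"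
    then have "?\<phi> s \<ge> 0" unfolding flux_def using dpos[of "u s"] u01[OF s]
      by (intro mult_nonneg_nonneg) auto
    with fneg[OF s] show False by simp
  qed
  have decr: "u t < u s" if st: "s \<in> ?I" "t \<in> ?I" "s < t" for s t
    by (rule DERIV_neg_imp_decreasing[OF st(3)])
      (use Du neg sub[OF st(1,2)] in \<open>meson atLeastAtMost_iff subsetD\<close>)
  have surj: "\<exists>t\<in>?I. u t = v" if v: "0 < v" "v < 1" for v
  proof -
    obtain t1 where t1: "t1 \<in> ?I" "v < u t1"
      using einterval_at_right[OF order_tendstoD(1)[OF lim(1) v(2)] ab] by auto
    obtain t2 where t2: "t2 \<in> ?I" "u t2 < v"
      using einterval_at_left[OF order_tendstoD(2)[OF lim(2) v(1)] ab] by auto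
    have "t1 \<le> t2" using decr[OF t2(1) t1(1)] t1 t2 by (cases "t1 \<le> t2") auto
    moreover have "continuous_on {t1..t2} u"
      using Du sub[OF t1(1) t2(1)] by (meson DERIV_isCont continuous_at_imp_continuous_on subsetD)
    ultimately obtain t where "t1 \<le> t" "t \<le> t2" "u t = v"
      using IVT2'[of u t2 v t1] t1 t2 by auto
    then show ?thesis using sub[OF t1(1) t2(1)] by (intro bexI[of _ t]) auto
  qed
  \<comment> \<open>Outside (0,1) the choice is arbitrary; nothing is claimed about \<open>w\<close>
    there.\<close>
  define T where "T v = (SOME t. t \<in> ?I \<and> u t = v)" for v
  have T: "T v \<in> ?I" "u (T v) = v" if "0 < v" "v < 1" for v
    using someI_ex[of "\<lambda>t. t \<in> ?I \<and> u t = v"] surj[OF that] by (auto simp: T_def)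
  have Tu: "T (u t) = t" if "t \<in> ?I" for t
    using T[of "u t"] u01[OF that] decr[OF that, of "T (u t)"] decr[of "T (u t)" t] that
    by (cases "T (u t)" t rule: linorder_cases) auto
  define w where "w v = - ?\<phi> (T v)" for v
  have wpos: "w v > 0" if "0 < v" "v < 1" for v
    using fneg[OF T(1)[OF that]] by (simp add: w_def)
  have slope: "deriv u t = - ((w (u t) / d (u t)) powr (1 / (p - 1)))" if t: "t \<in> ?I" for t
  proof -
    have "w (u t) = d (u t) * (\<bar>deriv u t\<bar> powr (p - 2) * \<bar>deriv u t\<bar> powr 1)"
      using neg[OF t] by (simp add: w_def Tu[OF t] flux_def)
    also have "\<dots> = d (u t) * \<bar>deriv u t\<bar> powr (p - 1)"
      by (subst powr_add[symmetric]) simp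
    finally have "w (u t) / d (u t) = \<bar>deriv u t\<bar> powr (p - 1)"
      using dpos[of "u t"] u01[OF t] by simp
    then show ?thesis using p neg[OF t] by (simp add: powr_powr)
  qed
  have "(w has_real_derivative c * g v - f v - damping w v) (at v)"
    if v: "0 < v" "v < 1" for v
  proof -
    let ?t = "T v"
    have t: "?t \<in> ?I" "u ?t = v" using T v by auto
    obtain e where e: "e > 0" "cball ?t e \<subseteq> ?I"
      using open_contains_cball[of ?I] t(1) open_einterval by blast
    \<comment> \<open>Differentiating an inverse presupposes its continuity; the closed ball inside
      the open interval supplies the neighbourhood on which \<open>T\<close> inverts
      \<open>u\<close>.\<close>
    have "isCont T (u ?t)"
    proof (rule isCont_inverse_function2[of "?t - e" ?t "?t + e"])
      show "T (u z) = z" if "?t - e \<le> z" "z \<le> ?t + e" for z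
        using e(2) that by (intro Tu) (auto simp: subset_iff dist_real_def)
      show "isCont u z" if "?t - e \<le> z" "z \<le> ?t + e" for z
        using e(2) that by (intro DERIV_isCont[OF Du]) (auto simp: subset_iff dist_real_def)
    qed (use e in auto)
    then have DT: "(T has_real_derivative inverse (deriv u ?t)) (at v)"
      using Du[OF t(1)] neg[OF t(1)] T v t
      by (intro DERIV_inverse_function[of u _ T v 0 1]) auto
    have "((\<lambda>v. - ?\<phi> (T v)) has_real_derivative - (deriv ?\<phi> ?t * inverse (deriv u ?t))) (at v)"
      by (intro DERIV_minus DERIV_chain2[OF D\<phi>[OF t(1)] DT])
    moreover have "- (deriv ?\<phi> ?t * inverse (deriv u ?t)) = c * g v - f v + \<rho> v / deriv u ?t"
      using eq[OF t(1)] neg[OF t(1)] t(2) by (simp add: field_simps)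
    moreover have "(d v / w v) powr (1 / (p - 1)) = 1 / (w v / d v) powr (1 / (p - 1))"
      using wpos[OF v] dpos[OF v] by (simp add: powr_divide)
    ultimately show ?thesis using slope[OF t(1)] t(2) by (simp add: w_def[abs_def] damping_def)
  qed
  moreover have "(w \<longlongrightarrow> 0) (at_right 0)"
  proof (rule tendstoI)
    fix e :: real assume "e > 0"
    from einterval_at_left[OF tendstoD[OF lim(4) this] ab] obtain t0
      where t0: "t0 \<in> ?I" "\<And>t. t \<in> ?I \<Longrightarrow> t0 \<le> t \<Longrightarrow> dist (?\<phi> t) 0 < e" by auto
    \<comment> \<open>Since \<open>u\<close> decreases, a level below \<open>u t0\<close> is reached
      only after \<open>t0\<close>, where the flux is already small.\<close>
    have "dist (w v) 0 < e" if "0 < v" "v < u t0" for v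
    proof -
      have "v < 1" using that u01[OF t0(1)] by simp
      then show ?thesis
        using t0(2)[of "T v"] T[of v] decr[of "T v" t0] t0(1) that by (force simp: w_def)
    qed
    then show "\<forall>\<^sub>F v in at_right 0. dist (w v) 0 < e"
      using u01[OF t0(1)] unfolding eventually_at_right_field by blast
  qed
  moreover have "(w \<longlongrightarrow> 0) (at_left 1)"
  proof (rule tendstoI)
    fix e :: real assume "e > 0"
    from einterval_at_right[OF tendstoD[OF lim(3) this] ab] obtain t0
      where t0: "t0 \<in> ?I" "\<And>t. t \<in> ?I \<Longrightarrow> t \<le> t0 \<Longrightarrow> dist (?\<phi> t) 0 < e" by auto
    have "dist (w v) 0 < e" if "u t0 < v" "v < 1" for v
    proof -
      have "0 < v" using that u01[OF t0(1)] by simp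
      then show ?thesis
        using t0(2)[of "T v"] T[of v] decr[of t0 "T v"] t0(1) that by (force simp: w_def)
    qed
    then show "\<forall>\<^sub>F v in at_left 1. dist (w v) 0 < e"
      using u01[OF t0(1)] unfolding eventually_at_left_field by blast
  qed
  ultimately have "first_order_solution c w"
    using wpos by (simp add: first_order_solution_def)
  then show ?thesis using that slope by blast
qed

section \<open>Comparison of first-order solutions\<close>

text \<open>The exponent 1/(p-1) is positive, so the larger of two solutions is damped less and the
  damping widens the gap between them.\<close>

lemma damping_strict_antimono:
  assumes "0 < v" "v < 1" "0 < w1 v" "w1 v < w v"
  shows "damping w v < damping w1 v"
  unfolding damping_def using assms dpos[of v] rhopos[of v] p
  by (intro mult_strict_left_mono powr_less_mono2 divide_strict_left_mono) auto

lemma eventually_unit_interval: "\<forall>\<^sub>F v::real in at_right 0. 0 < v \<and> v < 1"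
  unfolding eventually_at_right_field by (intro exI[of _ 1]) auto

text \<open>If the faster solution were larger near 0, the weaker damping would keep it ahead by at
  least (c - c1) times the integral of \<open>g\<close>, all the way to 1. There both solutions tend
  to 0 while that integral is positive.\<close>

lemma first_order_solution_antimono_speed:
  assumes w1: "first_order_solution c1 w1" and w: "first_order_solution c w" and "c1 < c"
  shows "\<forall>\<^sub>F v in at_right 0. w v \<le> w1 v"
proof -
  note sol1 = w1[unfolded first_order_solution_def] and sol = w[unfolded first_order_solution_def]
  have g_pos: "\<forall>\<^sub>F v in at_right 0. g v > 0"
    using order_tendstoD(1)[OF lim_g g0] .
  let ?\<phi>' = "\<lambda>v. (c * g v - f v - damping w v) - (c1 * g v - f v - damping w1 v)"
  have "(\<forall>\<^sub>F v in at_right 0. w v - w1 v > 0) \<or> (\<forall>\<^sub>F v in at_right 0. w v - w1 v \<le> 0)"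
  proof (rule pos_or_nonpos_at_right[where \<phi>' = ?\<phi>'], use g_pos eventually_unit_interval in eventually_elim)
    case (elim v)
    have "((\<lambda>v. w v - w1 v) has_real_derivative ?\<phi>' v) (at v)"
      using sol sol1 elim by (intro DERIV_diff) auto
    moreover have "?\<phi>' v > 0" if "w v - w1 v = 0"
    proof -
      \<comment> \<open>The dampings cancel where the two solutions meet.\<close>
      have "?\<phi>' v = (c - c1) * g v" using that by (simp add: damping_def algebra_simps)
      then show ?thesis using elim \<open>c1 < c\<close> by simp
    qed
    ultimately show ?case by blast
  qed
  moreover have False if above: "\<forall>\<^sub>F v in at_right 0. w v - w1 v > 0"
  proof -
    define G where "G v = integral {0..v} g" for v
    \<comment> \<open>Away from 0 the function \<open>g\<close> may change sign; only its integral
      \<open>G\<close> is known to be positive. Subtracting (c - c1) \<open>G\<close> removes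
      \<open>g\<close> from the derivative and leaves the difference of the dampings.\<close>
    define W where "W v = w v - w1 v - (c - c1) * G v" for v
    have contG: "continuous_on {0..1} G"
      unfolding G_def using integrable_continuous_real[OF cont_g] by (rule indefinite_integral_continuous_1)
    have DG: "(G has_real_derivative g v) (at v)" if "0 < v" "v < 1" for v
      using integral_has_real_derivative[OF cont_g, of v] that
      by (simp add: G_def[abs_def] at_within_Icc_at)
    have DW: "(W has_real_derivative damping w1 v - damping w v) (at v)" if v: "0 < v" "v < 1" for v
    proof -
      have "(W has_real_derivative ?\<phi>' v - (c - c1) * g v) (at v)"
        unfolding W_def[abs_def] using sol sol1 v by (intro DERIV_diff DERIV_cmult DG) auto
      then show ?thesis by (simp add: algebra_simps)
    qed
    have "(G \<longlongrightarrow> G 0) (at_right 0)" "(G \<longlongrightarrow> G 1) (at_left 1)"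
      using continuous_on_Icc_at_rightD[OF contG] continuous_on_Icc_at_leftD[OF contG] by auto
    moreover have "G 0 = 0" by (simp add: G_def)
    ultimately have G_lim: "(G \<longlongrightarrow> 0) (at_right 0)" "(G \<longlongrightarrow> G 1) (at_left 1)"
      by simp_all
    have W0: "(W \<longlongrightarrow> 0 - 0 - (c - c1) * 0) (at_right 0)"
      and W1: "(W \<longlongrightarrow> 0 - 0 - (c - c1) * G 1) (at_left 1)"
      unfolding W_def[abs_def] by (intro tendsto_intros G_lim; use sol sol1 in simp)+
    have "\<forall>\<^sub>F v in at_right 0. W v > 0"
    proof (rule pos_at_right_if_deriv_pos[where \<phi>' = "\<lambda>v. damping w1 v - damping w v"],
        use W0 in simp, use above eventually_unit_interval in eventually_elim)
      case (elim v)
      then show ?case using DW[of v] damping_strict_antimono[of v w1 w] sol1 by simp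
    qed
    then have "\<forall>\<^sub>F v in at_right 0. W v > 0 \<and> 0 < v \<and> v < 1"
      using eventually_unit_interval by eventually_elim simp
    then obtain x where x: "W x > 0" "0 < x" "x < 1"
      using eventually_happens trivial_limit_at_right_real by blast
    have "W y \<ge> 0" if y: "x < y" "y < 1" for y
    proof (rule ccontr)
      assume "\<not> W y \<ge> 0"
      have "W x \<le> 0"
      \<comment> \<open>At a zero of \<open>W\<close> the gap between \<open>w\<close> and
        \<open>w1\<close> equals (c - c1) \<open>G\<close> > 0, so the derivative of
        \<open>W\<close> is positive there.\<close>
      proof (rule nonpos_backwards[of x y W "\<lambda>v. damping w1 v - damping w v"])
        fix v assume "v \<in> {x..y}" "W v = 0"
        then have v: "0 < v" "v < 1" "w v - w1 v = (c - c1) * G v" using x y by (auto simp: W_def)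
        moreover have "G v > 0" using int_g[of v] v by (simp add: G_def)
        ultimately have "w1 v < w v" using \<open>c1 < c\<close>
          by (metis diff_gt_0_iff_gt mult_pos_pos)
        then show "damping w1 v - damping w v > 0"
          using damping_strict_antimono[of v w1 w] v sol1 by simp
      qed (use \<open>\<not> W y \<ge> 0\<close> x y DW in auto)
      with x show False by simp
    qed
    then have "\<forall>\<^sub>F y in at_left 1. W y \<ge> 0"
      using x unfolding eventually_at_left_field by blast
    then have "0 \<le> 0 - 0 - (c - c1) * G 1"
      by (intro tendsto_lowerbound[OF W1]) auto
    moreover have "(c - c1) * G 1 > 0" using int_g[of 1] \<open>c1 < c\<close> by (simp add: G_def)
    ultimately show False by simp
  qed
  ultimately show ?thesis by auto
qed

text \<open>The damping is nonnegative, so w' stays below \<open>a\<close> near 0, and w starts from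
  the limit 0.\<close>

lemma first_order_solution_upper:
  assumes w: "first_order_solution c w" and a: "c * g 0 - f 0 < a"
  shows "\<forall>\<^sub>F v in at_right 0. w v < a * v"
proof -
  note sol = w[unfolded first_order_solution_def]
  have "((\<lambda>v. c * g v - f v) \<longlongrightarrow> c * g 0 - f 0) (at_right 0)"
    by (intro tendsto_intros lim_g lim_f)
  from order_tendstoD(2)[OF this a] have ev: "\<forall>\<^sub>F v in at_right 0. c * g v - f v < a" .
  have "\<forall>\<^sub>F v in at_right 0. a * v - w v > 0"
  proof (rule pos_at_right_if_deriv_pos[where \<phi>' = "\<lambda>v. a * 1 - (c * g v - f v - damping w v)"])
    have "((\<lambda>v. a * v - w v) \<longlongrightarrow> a * 0 - 0) (at_right 0)"
      using sol by (intro tendsto_intros) auto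
    then show "((\<lambda>v. a * v - w v) \<longlongrightarrow> 0) (at_right 0)" by simp
    show "\<forall>\<^sub>F v in at_right 0. ((\<lambda>v. a * v - w v) has_real_derivative
        a * 1 - (c * g v - f v - damping w v)) (at v) \<and> a * 1 - (c * g v - f v - damping w v) > 0"
      using ev eventually_unit_interval
    proof eventually_elim
      case (elim v)
      then have "damping w v \<ge> 0" using rhopos[of v] by (simp add: damping_def)
      then show ?case using elim sol by (auto intro!: DERIV_diff DERIV_cmult)
    qed
  qed
  then show ?thesis by simp
qed

text \<open>Moving \<rho> inside the power exposes the product d \<rho>^(p-1), which is what \<xi>
  controls.\<close>

lemma damping_eq:
  assumes "0 < v" "v < 1" "w v > 0"
  shows "damping w v = (d v * \<rho> v powr (p - 1) / w v) powr (1 / (p - 1))"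
  using assms dpos[of v] rhopos[of v] p
  by (simp add: damping_def powr_mult powr_divide powr_powr)

end

section \<open>Two-sided bounds for the damping near 0\<close>

locale C1_comparison = reaction_convection +
  fixes \<delta> \<mu> M :: real and \<xi> :: "real \<Rightarrow> real"
  assumes const_pos: "\<delta> > 0" "\<mu> > 0" "M > 0"
    and C1_\<xi>: "C1_on \<xi> {0..\<delta>}"
    and \<xi>: "\<forall>v\<in>{0<..<\<delta>}. \<mu> * \<xi> v \<le> d v * \<rho> v powr (p - 1) \<and> d v * \<rho> v powr (p - 1) \<le> M * \<xi> v"
begin

lemma \<xi>_pos:
  assumes "0 < v" "v < 1" "v < \<delta>"
  shows "\<xi> v > 0"
proof -
  have "0 < d v * \<rho> v powr (p - 1)" using dpos[of v] rhopos[of v] assms by simp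
  also have "\<dots> \<le> M * \<xi> v" using \<xi> assms by simp
  finally show ?thesis using const_pos by (simp add: zero_less_mult_iff)
qed

text \<open>The multiple \<open>k * \<xi>\<close> is a barrier tuned through \<open>k\<close>: a
  large \<open>k\<close> makes the damping above it small, and in \<open>damping_ge\<close> a small
  \<open>k\<close> makes the damping below it large.\<close>

lemma damping_le:
  assumes v: "0 < v" "v < 1" "v < \<delta>" "w v > 0" and k: "k > 0" "k * \<xi> v \<le> w v"
  shows "damping w v \<le> (M / k) powr (1 / (p - 1))"
proof -
  have "d v * \<rho> v powr (p - 1) \<le> M / k * (k * \<xi> v)" using \<xi> v k by simp
  also have "\<dots> \<le> M / k * w v" using k const_pos by (intro mult_left_mono) auto
  finally have "d v * \<rho> v powr (p - 1) / w v \<le> M / k" using v by (simp add: field_simps)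
  then show ?thesis
    unfolding damping_eq[of v w, OF v(1,2,4)] using p v dpos[of v] by (intro powr_mono2) auto
qed

lemma damping_ge:
  assumes v: "0 < v" "v < 1" "v < \<delta>" "w v > 0" and k: "k > 0" "w v \<le> k * \<xi> v"
  shows "damping w v \<ge> (\<mu> / k) powr (1 / (p - 1))"
proof -
  have "\<mu> / k * w v \<le> \<mu> / k * (k * \<xi> v)" using k const_pos by (intro mult_left_mono) auto
  also have "\<dots> \<le> d v * \<rho> v powr (p - 1)" using \<xi> v k by simp
  finally have "\<mu> / k \<le> d v * \<rho> v powr (p - 1) / w v" using v by (simp add: field_simps)
  then show ?thesis
    unfolding damping_eq[of v w, OF v(1,2,4)] using p k const_pos by (intro powr_mono2) auto
qed

lemma eventually_near_0: "\<forall>\<^sub>F v in at_right 0. 0 < v \<and> v < 1 \<and> v < \<delta>"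
  unfolding eventually_at_right_field using const_pos by (intro exI[of _ "min 1 \<delta>"]) auto

text \<open>The same number \<open>\<xi>' 0\<close> is the limit of the derivatives and the
  one-sided derivative at 0. So the behaviour of the quotient of \<xi> by v determines that of
  \<open>\<xi>'\<close> near 0.\<close>

lemma \<xi>_deriv:
  obtains \<xi>' where "(\<xi>' \<longlongrightarrow> \<xi>' 0) (at_right 0)"
    and "(\<xi> has_real_derivative \<xi>' 0) (at_right 0)"
    and "\<And>v. 0 < v \<Longrightarrow> v < \<delta> \<Longrightarrow> (\<xi> has_real_derivative \<xi>' v) (at v)"
proof -
  from C1_\<xi> obtain \<xi>' where D: "\<And>x. x \<in> {0..\<delta>} \<Longrightarrow> (\<xi> has_real_derivative \<xi>' x) (at x within {0..\<delta>})"
    and cont: "continuous_on {0..\<delta>} \<xi>'" unfolding C1_on_def by blast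
  show ?thesis
  proof
    show "(\<xi>' \<longlongrightarrow> \<xi>' 0) (at_right 0)"
      using continuous_on_Icc_at_rightD[OF cont] const_pos by simp
    show "(\<xi> has_real_derivative \<xi>' 0) (at_right 0)"
      using D[of 0] const_pos by (simp add: at_within_Icc_at_right)
    show "(\<xi> has_real_derivative \<xi>' v) (at v)" if "0 < v" "v < \<delta>" for v
      using D[of v] that by (simp add: at_within_Icc_at)
  qed
qed

lemma damping_bounded_above:
  assumes w: "first_order_solution c w"
  obtains r where "\<forall>\<^sub>F v in at_right 0. damping w v \<le> r"
proof -
  note sol = w[unfolded first_order_solution_def]
  obtain \<xi>' where \<xi>'_lim: "(\<xi>' \<longlongrightarrow> \<xi>' 0) (at_right 0)"
    and D\<xi>: "\<And>v. 0 < v \<Longrightarrow> v < \<delta> \<Longrightarrow> (\<xi> has_real_derivative \<xi>' v) (at v)"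
    using \<xi>_deriv by metis
  define A where "A = \<bar>c * g 0 - f 0\<bar> + 1"
  define B where "B = \<bar>\<xi>' 0\<bar> + 1"
  \<comment> \<open>Where \<open>w\<close> \<le> \<open>k * \<xi>\<close>, the damping is at least
    \<open>N\<close>, so w' < \<open>A - N\<close> = \<open>- B - 1\<close>, which is negative and
    also below \<open>k * \<xi>'\<close> because \<open>k\<close> \<le> 1 and \<open>\<xi>'\<close>
    > \<open>- B\<close>. The second entry of the minimum solves (\<mu>/k)^(1/(p-1)) = N.\<close>
  define N where "N = A + B + 1"
  define k where "k = min 1 (\<mu> / N powr (p - 1))"
  have N: "N > 0" "B > 0" by (auto simp: N_def A_def B_def)
  have k: "0 < k" "k \<le> 1" using N const_pos by (auto simp: k_def)
  have "N powr (p - 1) \<le> \<mu> / k"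
    using k N const_pos min.cobounded2[of 1 "\<mu> / N powr (p - 1)"] by (simp add: k_def[symmetric] field_simps)
  then have "(N powr (p - 1)) powr (1 / (p - 1)) \<le> (\<mu> / k) powr (1 / (p - 1))"
    using p by (intro powr_mono2) auto
  then have Nk: "N \<le> (\<mu> / k) powr (1 / (p - 1))" using p N by (simp add: powr_powr)
  have "((\<lambda>v. c * g v - f v) \<longlongrightarrow> c * g 0 - f 0) (at_right 0)"
    by (intro tendsto_intros lim_g lim_f)
  then have evA: "\<forall>\<^sub>F v in at_right 0. c * g v - f v < A"
    by (rule order_tendstoD) (simp add: A_def)
  have evB: "\<forall>\<^sub>F v in at_right 0. - B < \<xi>' v"
    using \<xi>'_lim by (rule order_tendstoD) (simp add: B_def)
  define w' where "w' v = c * g v - f v - damping w v" for v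
  have "\<forall>\<^sub>F v in at_right 0. 0 < w v \<and> (w has_real_derivative w' v) (at v)
      \<and> (k * \<xi> v - w v \<ge> 0 \<longrightarrow> w' v < 0 \<and> k * \<xi>' v - w' v > 0)"
    using evA evB eventually_near_0
  proof eventually_elim
    case (elim v)
    have pos: "0 < w v" and D: "(w has_real_derivative w' v) (at v)"
      using sol elim by (auto simp: w'_def)
    have "w' v < 0 \<and> k * \<xi>' v - w' v > 0" if "k * \<xi> v - w v \<ge> 0"
    proof -
      have "damping w v \<ge> N" using damping_ge[of v w k] elim k pos that Nk by auto
      then have "w' v < - B - 1" using elim by (simp add: w'_def N_def)
      moreover have "k * \<xi>' v \<ge> k * (- B)" using elim k by (intro mult_left_mono) auto
      moreover have "k * B \<le> 1 * B" using k N by (intro mult_right_mono) auto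
      ultimately show ?thesis using N by linarith
    qed
    with pos D show ?case by blast
  qed
  note ev = this
  have "(\<forall>\<^sub>F v in at_right 0. k * \<xi> v - w v > 0) \<or> (\<forall>\<^sub>F v in at_right 0. k * \<xi> v - w v \<le> 0)"
    by (rule pos_or_nonpos_at_right[where \<phi>' = "\<lambda>v. k * \<xi>' v - w' v"],
        use ev eventually_near_0 in eventually_elim)
      (auto intro!: DERIV_diff DERIV_cmult D\<xi>)
  moreover have False if "\<forall>\<^sub>F v in at_right 0. k * \<xi> v - w v > 0"
  proof -
    have "\<forall>\<^sub>F v in at_right 0. - w v > 0"
    proof (rule pos_at_right_if_deriv_pos[where \<phi>' = "\<lambda>v. - w' v"])
      show "((\<lambda>v. - w v) \<longlongrightarrow> 0) (at_right 0)" using sol tendsto_minus[of w 0] by simp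
      show "\<forall>\<^sub>F v in at_right 0. ((\<lambda>v. - w v) has_real_derivative - w' v) (at v) \<and> 0 < - w' v"
        using ev that by eventually_elim (auto intro!: DERIV_minus)
    qed
    with ev have "\<forall>\<^sub>F v::real in at_right 0. False" by eventually_elim auto
    then show False by simp
  qed
  ultimately have "\<forall>\<^sub>F v in at_right 0. k * \<xi> v - w v \<le> 0" by blast
  with ev eventually_near_0 have "\<forall>\<^sub>F v in at_right 0. damping w v \<le> (M / k) powr (1 / (p - 1))"
    by eventually_elim (use k in \<open>auto intro!: damping_le\<close>)
  then show ?thesis using that by blast
qed

text \<open>Raising the vanishing expression to the power p - 1 gives d \<rho>^(p-1) / v, which
  dominates \<mu> \<xi>(v) / v.\<close>

lemma \<xi>_deriv_0:
  assumes l0: "((\<lambda>v. \<rho> v * (d v / v) powr (1 / (p - 1))) \<longlongrightarrow> 0) (at_right 0)"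
    and D: "(\<xi> has_real_derivative D) (at_right 0)"
  shows "D = 0"
proof -
  have "((\<lambda>v. (\<rho> v * (d v / v) powr (1 / (p - 1))) powr (p - 1)) \<longlongrightarrow> 0) (at_right 0)"
    using p eventually_near_0
    by (intro tendsto_zero_powrI[OF l0 tendsto_const])
      (auto elim!: eventually_mono intro!: mult_nonneg_nonneg less_imp_le[OF rhopos])
  then have "((\<lambda>v. (\<rho> v * (d v / v) powr (1 / (p - 1))) powr (p - 1) / \<mu>) \<longlongrightarrow> 0 / \<mu>) (at_right 0)"
    using const_pos by (intro tendsto_intros) auto
  then have up: "((\<lambda>v. (\<rho> v * (d v / v) powr (1 / (p - 1))) powr (p - 1) / \<mu>) \<longlongrightarrow> 0) (at_right 0)"
    by simp
  have q: "((\<lambda>v. \<xi> v / v) \<longlongrightarrow> 0) (at_right 0)"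
  proof (rule tendsto_sandwich[OF _ _ tendsto_const up])
    show "\<forall>\<^sub>F v in at_right 0. 0 \<le> \<xi> v / v"
      using eventually_near_0 by eventually_elim (use \<xi>_pos in \<open>force intro!: divide_nonneg_nonneg\<close>)
    show "\<forall>\<^sub>F v in at_right 0. \<xi> v / v \<le> (\<rho> v * (d v / v) powr (1 / (p - 1))) powr (p - 1) / \<mu>"
      using eventually_near_0
    proof eventually_elim
      case (elim v)
      have "(\<rho> v * (d v / v) powr (1 / (p - 1))) powr (p - 1) = d v * \<rho> v powr (p - 1) / v"
        using p elim dpos[of v] rhopos[of v] by (simp add: powr_mult powr_powr)
      moreover have "\<mu> * \<xi> v \<le> d v * \<rho> v powr (p - 1)" using \<xi> elim by auto
      ultimately show ?case using elim const_pos by (simp add: field_simps)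
    qed
  qed
  \<comment> \<open>The quotient \<xi>(v)/v is the difference quotient at 0 only once \<xi>(0) = 0
    is known.\<close>
  have "((\<lambda>v. \<xi> v / v * v) \<longlongrightarrow> 0 * 0) (at_right 0)"
    by (intro tendsto_mult q tendsto_ident_at)
  then have "((\<lambda>v. \<xi> v / v * v) \<longlongrightarrow> 0) (at_right 0)"
    by simp
  then have "(\<xi> \<longlongrightarrow> 0) (at_right 0)"
    by (rule Lim_transform_eventually) (rule eventually_mono[OF eventually_near_0], simp)
  moreover have "(\<xi> \<longlongrightarrow> \<xi> 0) (at_right 0)"
    using DERIV_continuous[OF D] by (simp add: continuous_within)
  ultimately have "\<xi> 0 = 0"
    using tendsto_unique trivial_limit_at_right_real by blast
  then have "((\<lambda>v. \<xi> v / v) \<longlongrightarrow> D) (at_right 0)"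
    using D by (simp add: has_field_derivative_iff)
  with q show ?thesis
    using tendsto_unique trivial_limit_at_right_real by blast
qed

text \<open>The linear bound on \<open>w\<close> has two uses: for \<open>l0\<close> > 0 it is
  inserted into the damping, for \<open>l0\<close> = 0 it is what a solution above the barrier would
  violate.\<close>

lemma damping_bounded_below:
  assumes w: "first_order_solution c w"
    and l0: "((\<lambda>v. \<rho> v * (d v / v) powr (1 / (p - 1))) \<longlongrightarrow> l0) (at_right 0)"
    and upper: "\<forall>\<^sub>F v in at_right 0. w v < a * v" and a: "a < c * g 0 - f 0"
  obtains r where "r > 0" "\<forall>\<^sub>F v in at_right 0. r \<le> damping w v"
proof -
  note sol = w[unfolded first_order_solution_def]
  have "\<forall>\<^sub>F v in at_right 0. 0 < w v \<and> w v < a * v \<and> 0 < v"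
    using upper eventually_near_0 by eventually_elim (use sol in auto)
  then obtain v where "0 < w v" "w v < a * v" "0 < v"
    using eventually_happens'[OF trivial_limit_at_right_real] by blast
  then have a_pos: "a > 0" by (smt (verit) zero_less_mult_pos2)
  have "\<forall>\<^sub>F v in at_right 0. 0 \<le> \<rho> v * (d v / v) powr (1 / (p - 1))"
    using eventually_near_0 by eventually_elim (use rhopos in \<open>force intro!: mult_nonneg_nonneg\<close>)
  then have "l0 \<ge> 0" by (intro tendsto_lowerbound[OF l0]) auto
  then consider "l0 > 0" | "l0 = 0" by force
  then show ?thesis
  proof cases
    case 1
    \<comment> \<open>The damping is \<rho> (d/v)^(1/(p-1)) times (v/w)^(1/(p-1)); near 0 the first
      factor exceeds \<open>l0 / 2\<close> and the second is at least (1/a)^(1/(p-1)).\<close>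
    define r where "r = l0 / 2 * (1 / a) powr (1 / (p - 1))"
    have "\<forall>\<^sub>F v in at_right 0. l0 / 2 < \<rho> v * (d v / v) powr (1 / (p - 1))"
      using order_tendstoD(1)[OF l0, of "l0 / 2"] 1 by simp
    then have "\<forall>\<^sub>F v in at_right 0. r \<le> damping w v"
      using upper eventually_near_0
    proof eventually_elim
      case (elim v)
      then have pos: "w v > 0" "d v > 0" "\<rho> v > 0" using sol dpos[of v] rhopos[of v] by auto
      have "(1 / a) powr (1 / (p - 1)) \<le> (v / w v) powr (1 / (p - 1))"
        using elim pos a_pos p by (intro powr_mono2) (auto simp: field_simps)
      then have "r \<le> (\<rho> v * (d v / v) powr (1 / (p - 1))) * (v / w v) powr (1 / (p - 1))"
        unfolding r_def using elim pos 1 by (intro mult_mono) auto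
      also have "\<dots> = damping w v"
        using elim pos by (simp add: damping_def powr_divide)
      finally show ?case .
    qed
    moreover have "r > 0" using 1 a_pos by (simp add: r_def)
    ultimately show ?thesis using that by blast
  next
    case 2
    obtain \<xi>' where \<xi>': "(\<xi>' \<longlongrightarrow> \<xi>' 0) (at_right 0)" "(\<xi> has_real_derivative \<xi>' 0) (at_right 0)"
      and D\<xi>: "\<And>v. 0 < v \<Longrightarrow> v < \<delta> \<Longrightarrow> (\<xi> has_real_derivative \<xi>' v) (at v)"
      using \<xi>_deriv by metis
    have \<xi>'_lim: "(\<xi>' \<longlongrightarrow> 0) (at_right 0)"
      using \<xi>' \<xi>_deriv_0[OF l0[unfolded 2]] by metis
    \<comment> \<open>Of the gap above \<open>a\<close>, one third pays for the variation of c g - f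
      and one for the damping above the barrier; the last third keeps w' > \<open>a\<close>. The
      value of \<open>k\<close> solves (M/k)^(1/(p-1)) = e.\<close>
    define e where "e = (c * g 0 - f 0 - a) / 3"
    define k where "k = M / e powr (p - 1)"
    have e: "e > 0" using a by (simp add: e_def)
    then have k: "k > 0" and Mk: "(M / k) powr (1 / (p - 1)) = e"
      using const_pos p by (auto simp: k_def powr_powr)
    have "((\<lambda>v. c * g v - f v) \<longlongrightarrow> c * g 0 - f 0) (at_right 0)"
      by (intro tendsto_intros lim_g lim_f)
    then have evA: "\<forall>\<^sub>F v in at_right 0. c * g 0 - f 0 - e < c * g v - f v"
      by (rule order_tendstoD) (use e in simp)
    \<comment> \<open>Since \<open>k\<close> is already fixed, the barrier has slope below
      \<open>a\<close> only because \<open>\<xi>'\<close> tends to 0.\<close>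
    have "((\<lambda>v. k * \<xi>' v) \<longlongrightarrow> k * 0) (at_right 0)"
      by (intro tendsto_intros \<xi>'_lim)
    then have evB: "\<forall>\<^sub>F v in at_right 0. k * \<xi>' v < a"
      by (rule order_tendstoD) (use a_pos in simp)
    define w' where "w' v = c * g v - f v - damping w v" for v
    have ev: "\<forall>\<^sub>F v in at_right 0. 0 < w v \<and> (w has_real_derivative w' v) (at v)
        \<and> (w v - k * \<xi> v \<ge> 0 \<longrightarrow> w' v > a \<and> w' v - k * \<xi>' v > 0)"
      using evA evB eventually_near_0
    proof eventually_elim
      case (elim v)
      have pos: "0 < w v" and D: "(w has_real_derivative w' v) (at v)"
        using sol elim by (auto simp: w'_def)
      have "w' v > a" if "w v - k * \<xi> v \<ge> 0"
      proof -
        have "damping w v \<le> e" using damping_le[of v w k] elim k pos that Mk by auto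
        then have "w' v > c * g 0 - f 0 - 2 * e" using elim by (simp add: w'_def)
        moreover have "3 * e = c * g 0 - f 0 - a" by (simp add: e_def)
        ultimately show ?thesis using e by linarith
      qed
      with pos D elim show ?case by force
    qed
    have "(\<forall>\<^sub>F v in at_right 0. w v - k * \<xi> v > 0) \<or> (\<forall>\<^sub>F v in at_right 0. w v - k * \<xi> v \<le> 0)"
      by (rule pos_or_nonpos_at_right[where \<phi>' = "\<lambda>v. w' v - k * \<xi>' v"],
          use ev eventually_near_0 in eventually_elim)
        (auto intro!: DERIV_diff DERIV_cmult D\<xi>)
    moreover have False if "\<forall>\<^sub>F v in at_right 0. w v - k * \<xi> v > 0"
    proof -
      have "\<forall>\<^sub>F v in at_right 0. w v - a * v > 0"
      proof (rule pos_at_right_if_deriv_pos[where \<phi>' = "\<lambda>v. w' v - a * 1"])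
        have "((\<lambda>v. w v - a * v) \<longlongrightarrow> 0 - a * 0) (at_right 0)"
          using sol by (intro tendsto_intros) auto
        then show "((\<lambda>v. w v - a * v) \<longlongrightarrow> 0) (at_right 0)" by simp
        show "\<forall>\<^sub>F v in at_right 0. ((\<lambda>v. w v - a * v) has_real_derivative w' v - a * 1) (at v)
            \<and> 0 < w' v - a * 1"
          using ev that by eventually_elim (auto intro!: DERIV_diff DERIV_cmult)
      qed
      with upper have "\<forall>\<^sub>F v::real in at_right 0. False" by eventually_elim auto
      then show False by simp
    qed
    ultimately have "\<forall>\<^sub>F v in at_right 0. w v - k * \<xi> v \<le> 0" by blast
    with ev eventually_near_0 have "\<forall>\<^sub>F v in at_right 0. (\<mu> / k) powr (1 / (p - 1)) \<le> damping w v"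
      by eventually_elim (use k in \<open>auto intro!: damping_ge\<close>)
    moreover have "(\<mu> / k) powr (1 / (p - 1)) > 0" using k const_pos by simp
    ultimately show ?thesis using that by blast
  qed
qed

end

section \<open>The improper integral of 1/\<rho>\<close>

text \<open>Monotone convergence along the lower ends b/(n+1).\<close>

lemma set_nn_integral_Ioc_le:
  fixes h :: "real \<Rightarrow> ennreal"
  assumes meas: "\<And>v. 0 < v \<Longrightarrow> v \<le> b \<Longrightarrow> (\<lambda>x. h x * indicator {v..b} x) \<in> borel_measurable lborel"
    and le: "\<And>v. 0 < v \<Longrightarrow> v \<le> b \<Longrightarrow> (\<integral>\<^sup>+x\<in>{v..b}. h x \<partial>lborel) \<le> B"
    and "b > 0"
  shows "(\<integral>\<^sup>+x\<in>{0<..b}. h x \<partial>lborel) \<le> B"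
proof -
  define v where "v n = b / real (Suc n)" for n
  have v: "0 < v n" "v n \<le> b" for n
    using \<open>b > 0\<close> by (auto simp: v_def field_simps)
  have v_mono: "v n \<le> v m" if "m \<le> n" for m n
    unfolding v_def using that \<open>b > 0\<close> by (intro divide_left_mono) auto
  have "v \<longlonglongrightarrow> 0"
    unfolding v_def using tendsto_mult[OF tendsto_const[of b] LIMSEQ_inverse_real_of_nat]
    by (simp add: divide_inverse)
  have "(\<lambda>n. \<integral>\<^sup>+x\<in>{v n..b}. h x \<partial>lborel) \<longlonglongrightarrow> (\<integral>\<^sup>+x\<in>{0<..b}. h x \<partial>lborel)"
  proof (rule nn_integral_LIMSEQ)
    show "incseq (\<lambda>n x. h x * indicator {v n..b} x)"
      using v_mono by (force simp: incseq_def le_fun_def indicator_def intro: order_trans)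
    show "(\<lambda>x. h x * indicator {v n..b} x) \<in> borel_measurable lborel" for n
      by (rule meas[OF v])
    show "(\<lambda>n. h x * indicator {v n..b} x) \<longlonglongrightarrow> h x * indicator {0<..b} x" for x
    proof (cases "x \<in> {0<..b}")
      case True
      then have "\<forall>\<^sub>F n in sequentially. v n < x"
        using order_tendstoD(2)[OF \<open>v \<longlonglongrightarrow> 0\<close>] by auto
      then have "\<forall>\<^sub>F n in sequentially. h x * indicator {v n..b} x = h x * indicator {0<..b} x"
        by eventually_elim (use True in auto)
      then show ?thesis by (rule tendsto_eventually)
    next
      case False
      then have "x \<notin> {v n..b}" for n using v(1)[of n] by auto
      with False show ?thesis by simp
    qed
  qed
  then show ?thesis
    by (rule LIMSEQ_le_const2) (use le v in blast)
qed

lemma real_bounds_of_deriv_bounds: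
  fixes S :: "real \<Rightarrow> real"
  assumes "a \<le> b"
    and D: "\<And>x. a \<le> x \<Longrightarrow> x \<le> b \<Longrightarrow> (S has_real_derivative S' x) (at x) \<and> m \<le> S' x \<and> S' x \<le> n"
  shows "m * (b - a) \<le> S b - S a" "S b - S a \<le> n * (b - a)"
proof -
  have "S a - m * a \<le> S b - m * b"
    using D \<open>a \<le> b\<close>
    by (intro DERIV_nonneg_imp_nondecreasing[of a b "\<lambda>x. S x - m * x"])
      (auto intro!: exI[of _ "S' _ - m * 1"] DERIV_diff DERIV_cmult)
  moreover have "n * a - S a \<le> n * b - S b"
    using D \<open>a \<le> b\<close>
    by (intro DERIV_nonneg_imp_nondecreasing[of a b "\<lambda>x. n * x - S x"])
      (auto intro!: exI[of _ "n * 1 - S' _"] DERIV_diff DERIV_cmult)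
  ultimately show "m * (b - a) \<le> S b - S a" "S b - S a \<le> n * (b - a)"
    by (auto simp: algebra_simps)
qed

context reaction_convection
begin

lemma cont_inverse_\<rho>:
  assumes "0 < v"
  shows "continuous_on {v..1/2} (\<lambda>x. 1 / \<rho> x)"
proof (intro continuous_intros)
  show "continuous_on {v..1/2} \<rho>"
    using assms by (intro continuous_on_subset[OF cont_\<rho>]) auto
  show "\<forall>x\<in>{v..1/2}. \<rho> x \<noteq> 0"
  proof
    fix x assume "x \<in> {v..1/2}"
    then show "\<rho> x \<noteq> 0" using assms rhopos[of x] by auto
  qed
qed

lemma nn_integral_inverse_\<rho>:
  assumes "0 < v"
  shows "(\<integral>\<^sup>+x\<in>{v..1/2}. ennreal (1 / \<rho> x) \<partial>lborel) = ennreal (integral {v..1/2} (\<lambda>x. 1 / \<rho> x))"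
proof (rule nn_integral_has_integral_lebesgue')
  show "((\<lambda>x. 1 / \<rho> x) has_integral integral {v..1/2} (\<lambda>x. 1 / \<rho> x)) {v..1/2}"
    using integrable_continuous_real[OF cont_inverse_\<rho>[OF assms]] by (rule integrable_integral)
  show "0 \<le> 1 / \<rho> x" if "x \<in> {v..1/2}" for x using that assms rhopos[of x] by auto
qed

lemma DERIV_integral_inverse_\<rho>:
  assumes "0 < v" "v < 1/2"
  shows "((\<lambda>v. integral {v..1/2} (\<lambda>x. 1 / \<rho> x)) has_real_derivative - (1 / \<rho> v)) (at v)"
  \<comment> \<open>Starting the interval at \<open>v/2\<close> puts \<open>v\<close> in its
    interior, where the derivative is two-sided.\<close>
  using integral_has_real_derivative'[OF cont_inverse_\<rho>[of "v/2"], of v] assms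
  by (simp add: at_within_Icc_at)

text \<open>Together with \<open>integral_inverse_\<rho>_le\<close>, this reduces finiteness of the
  improper integral to a uniform bound on proper ones.\<close>

lemma set_nn_integral_inverse_\<rho>_le:
  assumes "\<And>v. 0 < v \<Longrightarrow> v \<le> 1/2 \<Longrightarrow> integral {v..1/2} (\<lambda>x. 1 / \<rho> x) \<le> B"
  shows "(\<integral>\<^sup>+x\<in>{0<..1/2}. ennreal (1 / \<rho> x) \<partial>lborel) \<le> ennreal B"
proof (rule set_nn_integral_Ioc_le)
  fix v :: real assume v: "0 < v" "v \<le> 1/2"
  have "(\<lambda>x. ennreal (indicator {v..1/2} x *\<^sub>R (1 / \<rho> x))) \<in> borel_measurable borel"
    using borel_measurable_continuous_on_indicator[OF _ cont_inverse_\<rho>[OF v(1)]] by simp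
  also have "(\<lambda>x. ennreal (indicator {v..1/2} x *\<^sub>R (1 / \<rho> x)))
      = (\<lambda>x. ennreal (1 / \<rho> x) * indicator {v..1/2} x)"
    by (auto simp: indicator_def)
  finally show "(\<lambda>x. ennreal (1 / \<rho> x) * indicator {v..1/2} x) \<in> borel_measurable lborel"
    by simp
  show "(\<integral>\<^sup>+x\<in>{v..1/2}. ennreal (1 / \<rho> x) \<partial>lborel) \<le> ennreal B"
    unfolding nn_integral_inverse_\<rho>[OF v(1)] using assms[OF v] by (rule ennreal_leI)
qed simp

lemma integral_inverse_\<rho>_le:
  assumes "0 < v"
  shows "ennreal (integral {v..1/2} (\<lambda>x. 1 / \<rho> x)) \<le> (\<integral>\<^sup>+x\<in>{0<..1/2}. ennreal (1 / \<rho> x) \<partial>lborel)"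
  unfolding nn_integral_inverse_\<rho>[OF assms, symmetric]
  using assms by (intro nn_integral_mono) (auto simp: indicator_def)

lemma integral_inverse_\<rho>_nonneg:
  assumes "0 < v"
  shows "0 \<le> integral {v..1/2} (\<lambda>x. 1 / \<rho> x)"
  using assms rhopos by (intro integral_nonneg integrable_continuous_real cont_inverse_\<rho>) (auto simp: less_imp_le)

section \<open>Behaviour of the wave at its right end\<close>

text \<open>Positivity of \<open>u\<close> makes its limit 0 an approach from the right, so facts
  about small levels can be read along the wave: as a filter for the limit of u', and from an
  explicit time on for the time estimates.\<close>

lemma wave_eventually_near_0:
  assumes tw: "traveling_wave p f g \<rho> d c \<alpha> \<beta> u" and P: "\<forall>\<^sub>F v in at_right 0. P v"
  shows "\<forall>\<^sub>F t in at_left \<beta>. P (u (real_of_ereal t))"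
    and "\<exists>t0\<in>einterval \<alpha> \<beta>. \<forall>t\<in>einterval \<alpha> \<beta>. t0 \<le> t \<longrightarrow> P (u t)"
proof -
  have ab: "\<alpha> < \<beta>" and lim: "((u \<circ> real_of_ereal) \<longlongrightarrow> 0) (at_left \<beta>)"
    and u01: "\<And>s. s \<in> einterval \<alpha> \<beta> \<Longrightarrow> 0 < u s"
    using tw by (auto simp: traveling_wave_def)
  have "\<forall>\<^sub>F t in at_left \<beta>. \<alpha> < t \<and> t < \<beta>"
    using ab by (auto simp: eventually_at_left[OF ab])
  then have "\<forall>\<^sub>F t in at_left \<beta>. (u \<circ> real_of_ereal) t > 0"
  proof eventually_elim
    case (elim t)
    then have "ereal (real_of_ereal t) = t" by (cases t) auto
    then show ?case using u01[of "real_of_ereal t"] elim by (simp add: einterval_def)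
  qed
  then have "filterlim (u \<circ> real_of_ereal) (at_right 0) (at_left \<beta>)"
    using lim by (auto simp: filterlim_at elim!: eventually_mono)
  then show ev: "\<forall>\<^sub>F t in at_left \<beta>. P (u (real_of_ereal t))"
    using P by (auto simp: filterlim_iff)
  show "\<exists>t0\<in>einterval \<alpha> \<beta>. \<forall>t\<in>einterval \<alpha> \<beta>. t0 \<le> t \<longrightarrow> P (u t)"
    using einterval_at_left[OF ev ab] by simp
qed

text \<open>A bounded damping means that \<open>- u'\<close> is comparable to \<open>\<rho> u\<close>, so the time needed to
  reach a small level is comparable to the integral of \<open>1 / \<rho>\<close>.\<close>

lemma wave_end_of_damping_bounds:
  assumes tw: "traveling_wave p f g \<rho> d c \<alpha> \<beta> u"
    and slope: "\<And>t. t \<in> einterval \<alpha> \<beta> \<Longrightarrow> deriv u t = - ((w (u t) / d (u t)) powr (1 / (p - 1)))"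
    and w: "first_order_solution c w"
    and r: "r0 > 0" "\<forall>\<^sub>F v in at_right 0. r0 \<le> damping w v \<and> damping w v \<le> r1"
  shows "\<beta> = \<infinity> \<longleftrightarrow> (\<integral>\<^sup>+x\<in>{0<..1/2}. ennreal (1 / \<rho> x) \<partial>lborel) = \<infinity>"
    and "((deriv u \<circ> real_of_ereal) \<longlongrightarrow> 0) (at_left \<beta>)"
proof -
  let ?I = "einterval \<alpha> \<beta>"
  let ?R = "\<lambda>v. integral {v..1/2} (\<lambda>x. 1 / \<rho> x)"
  let ?N = "\<integral>\<^sup>+x\<in>{0<..1/2}. ennreal (1 / \<rho> x) \<partial>lborel"
  have ab: "\<alpha> < \<beta>" and C1: "C1_on u ?I" and u01: "\<And>s. s \<in> ?I \<Longrightarrow> 0 < u s \<and> u s < 1"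
    using tw by (auto simp: traveling_wave_def)
  note Du = C1_on_open_DERIV[OF C1 open_einterval]
  have u': "deriv u t = - (\<rho> (u t) / damping w (u t))" if t: "t \<in> ?I" for t
  proof -
    have "w (u t) > 0" using w u01[OF t] by (simp add: first_order_solution_def)
    then show ?thesis
      using dpos[of "u t"] rhopos[of "u t"] u01[OF t] slope[OF t]
      by (simp add: damping_def powr_divide)
  qed
  have "\<forall>\<^sub>F v in at_right 0. v < 1/2 \<and> r0 \<le> damping w v \<and> damping w v \<le> r1"
    using r(2) eventually_at_right_real[of 0 "1/2"] by (auto elim: eventually_elim2)
  from wave_eventually_near_0(2)[OF tw this] obtain t0
    where t0: "t0 \<in> ?I" "\<And>t. t \<in> ?I \<Longrightarrow> t0 \<le> t \<Longrightarrow> u t < 1/2 \<and> r0 \<le> damping w (u t) \<and> damping w (u t) \<le> r1"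
    by blast
  have "r1 > 0" using t0(2)[OF t0(1)] r(1) by auto
  \<comment> \<open>\<open>?R (u t)\<close> acts as a clock: its derivative in t is the reciprocal
    of the damping, which lies between \<open>1 / r1\<close> and \<open>1 / r0\<close>.\<close>
  have time: "1 / r1 * (t - t0) \<le> ?R (u t) - ?R (u t0)" "?R (u t) - ?R (u t0) \<le> 1 / r0 * (t - t0)"
    if t: "t \<in> ?I" "t0 \<le> t" for t
  proof -
    have *: "((\<lambda>t. ?R (u t)) has_real_derivative 1 / damping w (u x)) (at x)
        \<and> 1 / r1 \<le> 1 / damping w (u x) \<and> 1 / damping w (u x) \<le> 1 / r0" if x: "t0 \<le> x" "x \<le> t" for x
    proof -
      have xI: "x \<in> ?I" using einterval_Icc_subset[OF t0(1) t(1)] x by auto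
      have "((\<lambda>t. ?R (u t)) has_real_derivative - (1 / \<rho> (u x)) * deriv u x) (at x)"
        using t0(2)[OF xI x(1)] u01[OF xI] Du[OF xI]
        by (intro DERIV_chain2[OF DERIV_integral_inverse_\<rho>]) auto
      moreover have "- (1 / \<rho> (u x)) * deriv u x = 1 / damping w (u x)"
        using rhopos[of "u x"] u01[OF xI] by (simp add: u'[OF xI])
      ultimately show ?thesis using t0(2)[OF xI x(1)] r(1) by (auto intro: divide_left_mono)
    qed
    show "1 / r1 * (t - t0) \<le> ?R (u t) - ?R (u t0)" "?R (u t) - ?R (u t0) \<le> 1 / r0 * (t - t0)"
      using real_bounds_of_deriv_bounds[OF t(2) *] by auto
  qed
  show "\<beta> = \<infinity> \<longleftrightarrow> ?N = \<infinity>"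
  proof
    assume "\<beta> = \<infinity>"
    show "?N = \<infinity>"
    proof (rule ccontr)
      assume "?N \<noteq> \<infinity>"
      then obtain B where B: "0 \<le> B" "?N = ennreal B" by (cases ?N) auto
      \<comment> \<open>By this time the clock has advanced by at least \<open>B + 1\<close>, beyond
        the supposed total \<open>B\<close>; an infinite \<beta> makes the time admissible.\<close>
      define t where "t = t0 + r1 * (B + 1)"
      have t: "t0 \<le> t" using \<open>r1 > 0\<close> B by (simp add: t_def)
      then have "\<alpha> < ereal t" using t0(1) unfolding einterval_iff by (meson ereal_less_eq(3) less_le_trans)
      then have tI: "t \<in> ?I" using \<open>\<beta> = \<infinity>\<close> by (simp add: einterval_iff)
      have "B + 1 \<le> ?R (u t) - ?R (u t0)"
        using time(1)[OF tI t] \<open>r1 > 0\<close> by (simp add: t_def)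
      then have "B < ?R (u t)"
        using integral_inverse_\<rho>_nonneg[of "u t0"] u01[OF t0(1)] by simp
      moreover have "ennreal (?R (u t)) \<le> ennreal B"
        using integral_inverse_\<rho>_le[of "u t"] u01[OF tI] B by simp
      ultimately show False using B by (simp add: ennreal_le_iff)
    qed
  next
    assume N: "?N = \<infinity>"
    show "\<beta> = \<infinity>"
    proof (rule ccontr)
      assume "\<beta> \<noteq> \<infinity>"
      then obtain b where b: "\<beta> = ereal b" using ab by (cases \<beta>) auto
      \<comment> \<open>Before the finite end \<open>b\<close> the clock advances by at most
        \<open>(b - t0) / r0\<close>, yet the wave falls below every positive level.\<close>
      define B where "B = ?R (u t0) + 1 / r0 * (b - t0)"
      have "?N \<le> ennreal B"
      proof (rule set_nn_integral_inverse_\<rho>_le)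
        fix v :: real assume v: "0 < v" "v \<le> 1/2"
        have "\<forall>\<^sub>F x in at_right 0. x < v"
          using eventually_at_right_real[OF v(1)] by (auto elim: eventually_mono)
        from wave_eventually_near_0(2)[OF tw this] obtain t1
          where t1: "t1 \<in> ?I" "\<And>t. t \<in> ?I \<Longrightarrow> t1 \<le> t \<Longrightarrow> u t < v" by blast
        define t where "t = max t0 t1"
        have t: "t \<in> ?I" "t0 \<le> t" "u t < v" "t < b" 
          using t0(1) t1(1) t1(2)[of t] b by (auto simp: t_def max_def einterval_iff)
        have "ennreal (?R v) \<le> ennreal (?R (u t))"
          unfolding nn_integral_inverse_\<rho>[OF v(1), symmetric]
            nn_integral_inverse_\<rho>[of "u t", OF conjunct1[OF u01[OF t(1)]], symmetric]
          using t by (intro nn_integral_mono) (auto simp: indicator_def)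
        then have "?R v \<le> ?R (u t)"
          using integral_inverse_\<rho>_nonneg[of "u t"] u01[OF t(1)] by (simp add: ennreal_le_iff)
        also have "\<dots> \<le> ?R (u t0) + 1 / r0 * (t - t0)" using time(2)[OF t(1,2)] by simp
        also have "\<dots> \<le> B" unfolding B_def using t r(1) by (intro add_left_mono mult_left_mono) auto
        finally show "?R v \<le> B" .
      qed
      with N show False by (simp add: top_unique)
    qed
  qed
  show "((deriv u \<circ> real_of_ereal) \<longlongrightarrow> 0) (at_left \<beta>)"
  proof (rule tendstoI)
    fix e :: real assume "e > 0"
    \<comment> \<open>Along the wave |u'| is \<rho>(u) over the damping, hence at most \<rho>(u) /
      \<open>r0\<close>, whether \<beta> is finite or not.\<close>
    have "\<forall>\<^sub>F v in at_right 0. \<rho> v < r0 * e"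
      using order_tendstoD(2)[OF lim_\<rho>, of "r0 * e"] r(1) \<open>e > 0\<close> by simp
    then have "\<forall>\<^sub>F v in at_right 0. 0 < v \<and> v < 1 \<and> \<rho> v < r0 * e \<and> r0 \<le> damping w v"
      using r(2) eventually_unit_interval by eventually_elim auto
    then have "\<forall>\<^sub>F v in at_right 0. \<bar>\<rho> v / damping w v\<bar> < e"
    proof eventually_elim
      case (elim v)
      have "\<rho> v < r0 * e" using elim by simp
      also have "\<dots> \<le> damping w v * e" using elim \<open>e > 0\<close> by (intro mult_right_mono) auto
      finally have "\<rho> v < e * damping w v" by (simp add: mult.commute)
      then show ?case using elim r(1) rhopos[of v] by (simp add: field_simps)
    qed
    from wave_eventually_near_0(1)[OF tw this]
    have "\<forall>\<^sub>F t in at_left \<beta>. \<bar>\<rho> (u (real_of_ereal t)) / damping w (u (real_of_ereal t))\<bar> < e" .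
    moreover have "\<forall>\<^sub>F t in at_left \<beta>. \<alpha> < t \<and> t < \<beta>"
      using ab by (auto simp: eventually_at_left[OF ab])
    ultimately show "\<forall>\<^sub>F t in at_left \<beta>. dist ((deriv u \<circ> real_of_ereal) t) 0 < e"
    proof eventually_elim
      case (elim t)
      then have "ereal (real_of_ereal t) = t" by (cases t) auto
      then have "real_of_ereal t \<in> ?I" using elim by (simp add: einterval_iff)
      then show ?case using elim by (simp add: u')
    qed
  qed
qed

end

theorem theorem13:
  fixes p c cs l0 \<delta> \<mu> M :: real
    and f g \<rho> d u \<xi> :: "real \<Rightarrow> real"
    and \<alpha> \<beta> :: ereal
  assumes "standing_assumptions p f g \<rho> d"
    and "((\<lambda>v. \<rho> v * (d v / v) powr (1 / (p - 1))) \<longlongrightarrow> l0) (at_right 0)"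
    and "threshold_speed p f g \<rho> d cs"
    and "c > cs"
    and "traveling_wave p f g \<rho> d c \<alpha> \<beta> u"
    and "\<delta> > 0" and "\<mu> > 0" and "M > 0"
    and "C1_on \<xi> {0..\<delta>}"
    and "\<forall>v\<in>{0<..<\<delta>}. \<mu> * \<xi> v \<le> d v * \<rho> v powr (p - 1) \<and> d v * \<rho> v powr (p - 1) \<le> M * \<xi> v"
  shows "(\<beta> = \<infinity> \<longleftrightarrow> (\<integral>\<^sup>+ v \<in> {0<..1/2}. ennreal (1 / \<rho> v) \<partial>lborel) = \<infinity>) \<and>
         ((deriv u \<circ> real_of_ereal) \<longlongrightarrow> 0) (at_left \<beta>)"
proof -
  interpret C1_comparison p f g \<rho> d \<delta> \<mu> M \<xi>
    using assms by unfold_locales auto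
  \<comment> \<open>The threshold speed is itself attained; its wave supplies the slower solution
    for the comparison.\<close>
  obtain \<alpha>1 \<beta>1 u1 where "traveling_wave p f g \<rho> d cs \<alpha>1 \<beta>1 u1"
    using assms(3) unfolding threshold_speed_def by (meson order_refl)
  then obtain w1 where w1: "first_order_solution cs w1"
    by (rule traveling_wave_first_order)
  obtain w where w: "first_order_solution c w"
    and slope: "\<And>t. t \<in> einterval \<alpha> \<beta> \<Longrightarrow> deriv u t = - ((w (u t) / d (u t)) powr (1 / (p - 1)))"
    by (rule traveling_wave_first_order[OF assms(5)], rule that, assumption, blast)
  have "cs * g 0 - f 0 < c * g 0 - f 0" using g0 \<open>c > cs\<close> by simp
  \<comment> \<open>The strict inequality between the speeds opens this gap: \<open>a\<close> is
    steep enough to bound the threshold solution and too flat for an almost undamped one at speed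
    \<open>c\<close>.\<close>
  then obtain a where a: "cs * g 0 - f 0 < a" "a < c * g 0 - f 0" using dense by blast
  have "\<forall>\<^sub>F v in at_right 0. w v < a * v"
    using first_order_solution_antimono_speed[OF w1 w \<open>c > cs\<close>] first_order_solution_upper[OF w1 a(1)]
    by eventually_elim simp
  from damping_bounded_below[OF w assms(2) this a(2)] obtain r0
    where r0: "r0 > 0" "\<forall>\<^sub>F v in at_right 0. r0 \<le> damping w v" .
  from damping_bounded_above[OF w] obtain r1 where r1: "\<forall>\<^sub>F v in at_right 0. damping w v \<le> r1" .
  have "\<forall>\<^sub>F v in at_right 0. r0 \<le> damping w v \<and> damping w v \<le> r1"
    using r0(2) r1 by eventually_elim simp
  from wave_end_of_damping_bounds[OF assms(5) slope w r0(1) this] show ?thesis by blast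
qed

end
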